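(* Let $k\ge 1$ be an integer. There is a constant $C$ depending only on $k$ such that the following holds. Let $a<b$, let $\alpha>0$, and let $v\in C^{2k+1}([a,b])$ be periodic (i.e. $v$ is the restriction to $[a,b]$ of a $(b-a)$-periodic $C^{2k+1}$ function on $\mathbb{R}$). Let $\mathcal{D}_L,\mathcal{D}_R,\mathcal{D}_0$ be the operators with parameter $\alpha$ and periodic boundary treatment defined in the context. Then $$\left\Vert \partial_x v - \frac{\alpha}{2}\sum_{p=1}^{k}\mathcal{D}_0^{\,p-1}(\mathcal{D}_L-\mathcal{D}_R)[v,\alpha]\right\Vert_\infty \le C\left(\frac{1}{\alpha}\right)^{2k}\Vert \partial_x^{2k+1}v\Vert_\infty ,$$ where $\Vert\cdot\Vert_\infty$ is the sup norm on $[a,b]$.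
   Context: Fix an interval $[a,b]$ and $\alpha>0$, and put $\mu=e^{-\alpha(b-a)}$. For a continuous function $v$ on $[a,b]$ define $$I^{L}[v,\alpha](x)=\alpha\int_a^x e^{-\alpha(x-y)}v(y)\,dy,\qquad I^{R}[v,\alpha](x)=\alpha\int_x^b e^{-\alpha(y-x)}v(y)\,dy,$$ $$\mathcal{L}_L^{-1}[v,\alpha](x)=I^L[v,\alpha](x)+\frac{I^L[v,\alpha](b)}{1-\mu}e^{-\alpha(x-a)},\qquad \mathcal{L}_R^{-1}[v,\alpha](x)=I^R[v,\alpha](x)+\frac{I^R[v,\alpha](a)}{1-\mu}e^{-\alpha(b-x)}.$$ These are the inverses of $\mathcal{L}_L=\mathcal{I}+\frac1\alpha\partial_x$ and $\mathcal{L}_R=\mathcal{I}-\frac1\alpha\partial_x$ ($\mathcal{I}$ the identity) normalized so that the output takes equal values at $a$ and $b$. Define $$\mathcal{D}_L=\mathcal{I}-\mathcal{L}_L^{-1},\qquad \mathcal{D}_R=\mathcal{I}-\mathcal{L}_R^{-1},\qquad \mathcal{D}_0=\tfrac12(\mathcal{D}_L+\mathcal{D}_R).$$ Powers and products of these operators denote composition (all with the same parameter $\alpha$), and $\mathcal{D}_0^{0}=\mathcal{I}$. *)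

theory Defs
  imports "HOL-Analysis.Analysis"
begin

text \<open>Functions on \<open>[a,b]\<close> are represented by functions \<open>real \<Rightarrow> real\<close>; each notion below uses the
  values of its argument on \<open>{a..b}\<close> only, as long as the result is read at points of \<open>{a..b}\<close>.\<close>

definition int_L :: "real \<Rightarrow> real \<Rightarrow> real \<Rightarrow> (real \<Rightarrow> real) \<Rightarrow> real \<Rightarrow> real" where
  "int_L a b \<alpha> v x = \<alpha> * integral {a..x} (\<lambda>y. exp (- \<alpha> * (x - y)) * v y)"

definition int_R :: "real \<Rightarrow> real \<Rightarrow> real \<Rightarrow> (real \<Rightarrow> real) \<Rightarrow> real \<Rightarrow> real" where
  "int_R a b \<alpha> v x = \<alpha> * integral {x..b} (\<lambda>y. exp (- \<alpha> * (y - x)) * v y)"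

definition mu :: "real \<Rightarrow> real \<Rightarrow> real \<Rightarrow> real" where
  "mu a b \<alpha> = exp (- \<alpha> * (b - a))"

definition inv_L :: "real \<Rightarrow> real \<Rightarrow> real \<Rightarrow> (real \<Rightarrow> real) \<Rightarrow> real \<Rightarrow> real" where
  "inv_L a b \<alpha> v x =
     int_L a b \<alpha> v x + int_L a b \<alpha> v b / (1 - mu a b \<alpha>) * exp (- \<alpha> * (x - a))"

definition inv_R :: "real \<Rightarrow> real \<Rightarrow> real \<Rightarrow> (real \<Rightarrow> real) \<Rightarrow> real \<Rightarrow> real" where
  "inv_R a b \<alpha> v x =
     int_R a b \<alpha> v x + int_R a b \<alpha> v a / (1 - mu a b \<alpha>) * exp (- \<alpha> * (b - x))"

definition D_L :: "real \<Rightarrow> real \<Rightarrow> real \<Rightarrow> (real \<Rightarrow> real) \<Rightarrow> real \<Rightarrow> real" where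
  "D_L a b \<alpha> v x = v x - inv_L a b \<alpha> v x"

definition D_R :: "real \<Rightarrow> real \<Rightarrow> real \<Rightarrow> (real \<Rightarrow> real) \<Rightarrow> real \<Rightarrow> real" where
  "D_R a b \<alpha> v x = v x - inv_R a b \<alpha> v x"

definition D_0 :: "real \<Rightarrow> real \<Rightarrow> real \<Rightarrow> (real \<Rightarrow> real) \<Rightarrow> real \<Rightarrow> real" where
  "D_0 a b \<alpha> v x = (D_L a b \<alpha> v x + D_R a b \<alpha> v x) / 2"

text \<open>The derivative on \<open>[a,b]\<close>, one-sided at the end points.\<close>

definition deriv_on :: "real \<Rightarrow> real \<Rightarrow> (real \<Rightarrow> real) \<Rightarrow> real \<Rightarrow> real" where
  "deriv_on a b f x = vector_derivative f (at x within {a..b})"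

definition Ck_real :: "nat \<Rightarrow> (real \<Rightarrow> real) \<Rightarrow> bool" where
  "Ck_real n f \<longleftrightarrow>
     (\<forall>i<n. (deriv ^^ i) f differentiable_on UNIV) \<and> continuous_on UNIV ((deriv ^^ n) f)"

definition periodic_Ck_on :: "nat \<Rightarrow> real \<Rightarrow> real \<Rightarrow> (real \<Rightarrow> real) \<Rightarrow> bool" where
  "periodic_Ck_on n a b v \<longleftrightarrow>
     (\<exists>w. Ck_real n w \<and> (\<forall>x. w (x + (b - a)) = w x) \<and> (\<forall>x\<in>{a..b}. v x = w x))"

text \<open>A real supremum, meaningful for functions bounded on \<open>[a,b]\<close>; here it is only applied to
  functions that are continuous on \<open>[a,b]\<close>.\<close>

definition sup_norm :: "real \<Rightarrow> real \<Rightarrow> (real \<Rightarrow> real) \<Rightarrow> real" where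
  "sup_norm a b f = (SUP x\<in>{a..b}. \<bar>f x\<bar>)"

end

theory Submission
  imports Defs
begin

text \<open>On periodic functions \<open>D_L = (1/\<alpha>) L_L\<inverse> \<partial>\<close> and \<open>D_R = - (1/\<alpha>) L_R\<inverse> \<partial>\<close>.  Put
  \<open>G = I - D_0 = (L_L\<inverse> + L_R\<inverse>) / 2\<close>, which is the inverse of \<open>I - \<partial>\<^sup>2/\<alpha>\<^sup>2\<close>.  Then
  \<open>(\<alpha>/2) (D_L - D_R) v = G \<partial>v = (I - D_0) \<partial>v\<close>, so the sum telescopes and the error is
  \<open>D_0\<^sup>k \<partial>v\<close>.  Since \<open>D_0 = - \<alpha>\<^sup>-\<^sup>2 G \<partial>\<^sup>2\<close>, the error equals \<open>(- \<alpha>\<^sup>-\<^sup>2)\<^sup>k G\<^sup>k \<partial>\<^sup>2\<^sup>k\<^sup>+\<^sup>1 v\<close>.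
  Finally \<open>G\<close> is a positive operator with \<open>G 1 = 1\<close>, hence a contraction in the sup norm, and
  \<open>C = 1\<close> works.\<close>

context
  fixes a b \<alpha> :: real
  assumes ab: "a < b" and alpha: "\<alpha> > 0"
begin

section \<open>The left inverse: linearity, positivity, inversion of derivatives, sup-norm
  bound\<close>

lemma one_minus_mu_pos: "1 - mu a b \<alpha> > 0"
  using ab alpha by (simp add: mu_def)

lemma kernel_integrable:
  assumes "continuous_on {a..b} f" "x \<in> {a..b}"
  shows "(\<lambda>y. exp (- \<alpha> * (x - y)) * f y) integrable_on {a..x}"
  using assms by (intro integrable_continuous_real continuous_intros) (auto intro: continuous_on_subset)

lemma int_L_linear:
  assumes "continuous_on {a..b} f" "continuous_on {a..b} g" "x \<in> {a..b}"
  shows "int_L a b \<alpha> (\<lambda>y. c * f y + d * g y) x = c * int_L a b \<alpha> f x + d * int_L a b \<alpha> g x"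
proof -
  have "integral {a..x} (\<lambda>y. exp (- \<alpha> * (x - y)) * (c * f y + d * g y))
      = integral {a..x} (\<lambda>y. c * (exp (- \<alpha> * (x - y)) * f y) + d * (exp (- \<alpha> * (x - y)) * g y))"
    by (simp add: algebra_simps)
  also have "\<dots> = c * integral {a..x} (\<lambda>y. exp (- \<alpha> * (x - y)) * f y)
      + d * integral {a..x} (\<lambda>y. exp (- \<alpha> * (x - y)) * g y)"
    using kernel_integrable[OF assms(1,3)] kernel_integrable[OF assms(2,3)]
    by (subst integral_add) (auto intro!: integrable_on_mult_right)
  finally show ?thesis
    by (simp add: int_L_def algebra_simps)
qed

lemma inv_L_linear:
  assumes "continuous_on {a..b} f" "continuous_on {a..b} g" "x \<in> {a..b}"
  shows "inv_L a b \<alpha> (\<lambda>y. c * f y + d * g y) x = c * inv_L a b \<alpha> f x + d * inv_L a b \<alpha> g x"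
proof -
  have "b \<in> {a..b}" using ab by simp
  note lin = int_L_linear[OF assms] int_L_linear[OF assms(1,2) this]
  show ?thesis
    unfolding inv_L_def lin by (simp add: add_divide_distrib algebra_simps)
qed

lemma int_L_mono:
  assumes "continuous_on {a..b} f" "continuous_on {a..b} g" "x \<in> {a..b}"
    and "\<And>y. y \<in> {a..b} \<Longrightarrow> f y \<le> g y"
  shows "int_L a b \<alpha> f x \<le> int_L a b \<alpha> g x"
  unfolding int_L_def using assms alpha
  by (intro mult_left_mono integral_le kernel_integrable) auto

text \<open>The exponential kernel and the weight 1/(1 - mu) are positive. This positivity is the
  source of the sup-norm bound.\<close>

lemma inv_L_mono:
  assumes "continuous_on {a..b} f" "continuous_on {a..b} g" "x \<in> {a..b}"
    and "\<And>y. y \<in> {a..b} \<Longrightarrow> f y \<le> g y"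
  shows "inv_L a b \<alpha> f x \<le> inv_L a b \<alpha> g x"
  unfolding inv_L_def using assms ab one_minus_mu_pos
  by (intro add_mono mult_right_mono divide_right_mono int_L_mono) auto

lemma int_L_cong:
  assumes "x \<in> {a..b}" "\<And>y. y \<in> {a..b} \<Longrightarrow> f y = g y"
  shows "int_L a b \<alpha> f x = int_L a b \<alpha> g x"
  unfolding int_L_def using assms
  by (intro arg_cong2[where f = "(*)"] Henstock_Kurzweil_Integration.integral_cong) auto

text \<open>Needed because \<open>v\<close> agrees with its periodic extension on the interval
  only.\<close>

lemma inv_L_cong:
  assumes "x \<in> {a..b}" "\<And>y. y \<in> {a..b} \<Longrightarrow> f y = g y"
  shows "inv_L a b \<alpha> f x = inv_L a b \<alpha> g x"
  unfolding inv_L_def using int_L_cong[OF _ assms(2)] assms(1) ab by simp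

lemma continuous_inv_L:
  assumes "continuous_on {a..b} f"
  shows "continuous_on {a..b} (inv_L a b \<alpha> f)"
proof -
  \<comment> \<open>Pulling out \<open>exp (- \<alpha> * x)\<close> frees the integrand of
    \<open>x\<close>, so continuity reduces to that of an indefinite integral.\<close>
  have "int_L a b \<alpha> f x = \<alpha> * exp (- \<alpha> * x) * integral {a..x} (\<lambda>y. exp (\<alpha> * y) * f y)" for x
  proof -
    have "(\<lambda>y. exp (- \<alpha> * (x - y)) * f y) = (\<lambda>y. exp (- \<alpha> * x) * (exp (\<alpha> * y) * f y))"
      by (auto simp: exp_add[symmetric] algebra_simps)
    then show ?thesis
      by (simp add: int_L_def)
  qed
  moreover have "continuous_on {a..b} (\<lambda>x. integral {a..x} (\<lambda>y. exp (\<alpha> * y) * f y))"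
    by (intro indefinite_integral_continuous_1 integrable_continuous_real continuous_intros assms)
  ultimately have "continuous_on {a..b} (int_L a b \<alpha> f)"
    by (auto intro!: continuous_intros)
  then show ?thesis
    unfolding inv_L_def[abs_def]
    by (intro continuous_intros) (auto intro!: order.strict_implies_not_eq[symmetric] one_minus_mu_pos)
qed

text \<open>Integration by parts, in the form \<open>(e\<^bsup>\<alpha> y\<^esup> f)' = \<alpha> e\<^bsup>\<alpha> y\<^esup> (f + f'/\<alpha>)\<close>.\<close>

lemma inv_L_deriv:
  assumes deriv: "\<And>x. x \<in> {a..b} \<Longrightarrow> (f has_real_derivative f' x) (at x within {a..b})"
    and cont: "continuous_on {a..b} f'" and per: "f a = f b" and x: "x \<in> {a..b}"
  shows "inv_L a b \<alpha> f' x = \<alpha> * (f x - inv_L a b \<alpha> f x)"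
proof -
  have contf: "continuous_on {a..b} f"
    using deriv by (meson DERIV_continuous_on)
  \<comment> \<open>The coefficient \<open>1\<close> is written out so that
    \<open>inv_L_linear\<close> matches this integrand below.\<close>
  have int: "int_L a b \<alpha> (\<lambda>y. 1 * f y + 1 / \<alpha> * f' y) z = f z - exp (- \<alpha> * (z - a)) * f a"
    if z: "z \<in> {a..b}" for z
  proof -
    have "((\<lambda>y. exp (- \<alpha> * (z - y)) * (1 * f y + 1 / \<alpha> * f' y)) has_integral
        (exp (- \<alpha> * (z - z)) * f z / \<alpha> - exp (- \<alpha> * (z - a)) * f a / \<alpha>)) {a..z}"
    proof (rule fundamental_theorem_of_calculus)
      fix y assume "y \<in> {a..z}"
      then have "(f has_real_derivative f' y) (at y within {a..z})"
        using z by (intro DERIV_subset[OF deriv]) auto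
      then have "((\<lambda>y. exp (- \<alpha> * (z - y)) * f y / \<alpha>) has_real_derivative
          exp (- \<alpha> * (z - y)) * (1 * f y + 1 / \<alpha> * f' y)) (at y within {a..z})"
        using alpha by (auto intro!: derivative_eq_intros simp: field_simps)
      then show "((\<lambda>y. exp (- \<alpha> * (z - y)) * f y / \<alpha>) has_vector_derivative
          exp (- \<alpha> * (z - y)) * (1 * f y + 1 / \<alpha> * f' y)) (at y within {a..z})"
        by (simp add: has_real_derivative_iff_has_vector_derivative)
    qed (use z in auto)
    from integral_unique[OF this] show ?thesis
      using alpha by (simp add: int_L_def field_simps)
  qed
  \<comment> \<open>By periodicity the value at \<open>b\<close> carries the factor 1 - mu. Division
    by it in \<open>inv_L\<close> restores exactly the boundary term lost at
    \<open>x\<close>.\<close>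
  have "int_L a b \<alpha> (\<lambda>y. 1 * f y + 1 / \<alpha> * f' y) b = (1 - mu a b \<alpha>) * f a"
    using int[of b] ab per by (simp add: mu_def algebra_simps)
  then have "inv_L a b \<alpha> (\<lambda>y. 1 * f y + 1 / \<alpha> * f' y) x = f x"
    unfolding inv_L_def int[OF x] using one_minus_mu_pos by simp
  then have "inv_L a b \<alpha> f x + inv_L a b \<alpha> f' x / \<alpha> = f x"
    unfolding inv_L_linear[OF contf cont x] by simp
  then show ?thesis
    using alpha by (simp add: field_simps)
qed

text \<open>A constant is periodic with derivative 0, and \<open>inv_L\<close> of 0 is 0, so
  \<open>inv_L_deriv\<close> forces the claim.\<close>

lemma inv_L_const:
  assumes "x \<in> {a..b}"
  shows "inv_L a b \<alpha> (\<lambda>_. c) x = c"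
proof -
  have "inv_L a b \<alpha> (\<lambda>_. 0) x = \<alpha> * (c - inv_L a b \<alpha> (\<lambda>_. c) x)"
    using assms by (intro inv_L_deriv[where f = "\<lambda>_. c"]) auto
  then show ?thesis
    using alpha by (simp add: inv_L_def int_L_def)
qed

text \<open>Positivity and preservation of constants squeeze the value between those for the
  constants \<open>- M\<close> and \<open>M\<close>.\<close>

lemma inv_L_bound:
  assumes "continuous_on {a..b} f" "\<And>y. y \<in> {a..b} \<Longrightarrow> \<bar>f y\<bar> \<le> M" "x \<in> {a..b}"
  shows "\<bar>inv_L a b \<alpha> f x\<bar> \<le> M"
proof -
  have "- M \<le> f y \<and> f y \<le> M" if "y \<in> {a..b}" for y
    using assms(2)[OF that] by linarith
  then have "inv_L a b \<alpha> (\<lambda>_. - M) x \<le> inv_L a b \<alpha> f x" "inv_L a b \<alpha> f x \<le> inv_L a b \<alpha> (\<lambda>_. M) x"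
    using assms by (auto intro!: inv_L_mono)
  then show ?thesis
    using assms(3) by (simp add: inv_L_const)
qed

section \<open>The right inverse, obtained from the left one by reflecting the interval\<close>

lemma continuous_reflect:
  fixes f :: "real \<Rightarrow> real"
  assumes "continuous_on {a..b} f"
  shows "continuous_on {a..b} (\<lambda>y. f (a + b - y))"
  by (rule continuous_on_compose2[OF assms]) (auto intro!: continuous_intros)

lemma int_R_reflect:
  assumes "continuous_on {a..b} f" "x \<in> {a..b}"
  shows "int_R a b \<alpha> f x = int_L a b \<alpha> (\<lambda>y. f (a + b - y)) (a + b - x)"
proof -
  define h where "h = (\<lambda>z. exp (- \<alpha> * (z - x)) * f z)"
  have "continuous_on {x..b} h"
    unfolding h_def using assms by (intro continuous_intros) (auto intro: continuous_on_subset)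
  \<comment> \<open>The end points are kept as shifts by \<open>a + b\<close> to fit
    \<open>integral_shift\<close>; the shifted integrand is \<open>h (- y)\<close>, to which
    reflection at 0 applies.\<close>
  then have "continuous_on {- b + (a + b)..- x + (a + b)} (\<lambda>y. h (a + b - y))"
    by (rule continuous_on_compose2) (auto intro!: continuous_intros)
  from integral_shift[OF this]
  have "integral {- b..- x} (\<lambda>y. h (- y)) = integral {a..a + b - x} (\<lambda>y. h (a + b - y))"
    by (simp add: o_def algebra_simps)
  then have "integral {x..b} h = integral {a..a + b - x} (\<lambda>y. h (a + b - y))"
    by (simp add: Henstock_Kurzweil_Integration.integral_reflect_real)
  then show ?thesis
    by (simp add: int_R_def int_L_def h_def algebra_simps)
qed

text \<open>The map y to a + b - y exchanges \<open>a\<close> and \<open>b\<close>, hence also the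
  two boundary corrections.\<close>

lemma inv_R_reflect:
  assumes "continuous_on {a..b} f" "x \<in> {a..b}"
  shows "inv_R a b \<alpha> f x = inv_L a b \<alpha> (\<lambda>y. f (a + b - y)) (a + b - x)"
proof -
  have "a \<in> {a..b}" using ab by simp
  then show ?thesis
    using assms by (simp add: inv_R_def inv_L_def int_R_reflect)
qed

lemma inv_R_linear:
  assumes "continuous_on {a..b} f" "continuous_on {a..b} g" "x \<in> {a..b}"
  shows "inv_R a b \<alpha> (\<lambda>y. c * f y + d * g y) x = c * inv_R a b \<alpha> f x + d * inv_R a b \<alpha> g x"
proof -
  have "continuous_on {a..b} (\<lambda>y. c * f y + d * g y)"
    using assms by (intro continuous_intros)
  then show ?thesis
    using assms by (simp add: inv_R_reflect inv_L_linear continuous_reflect)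
qed

text \<open>Shown directly from the integral, since the reflection identity is available for
  continuous functions only.\<close>

lemma inv_R_cong:
  assumes "x \<in> {a..b}" "\<And>y. y \<in> {a..b} \<Longrightarrow> f y = g y"
  shows "inv_R a b \<alpha> f x = inv_R a b \<alpha> g x"
proof -
  have "int_R a b \<alpha> f z = int_R a b \<alpha> g z" if "z \<in> {a..b}" for z
    unfolding int_R_def using assms(2) that
    by (intro arg_cong2[where f = "(*)"] Henstock_Kurzweil_Integration.integral_cong) auto
  then show ?thesis
    unfolding inv_R_def using assms(1) ab by simp
qed

lemma continuous_inv_R:
  assumes "continuous_on {a..b} f"
  shows "continuous_on {a..b} (inv_R a b \<alpha> f)"
  using continuous_reflect[OF continuous_inv_L[OF continuous_reflect[OF assms]]]
  by (rule continuous_on_eq) (simp add: inv_R_reflect[OF assms])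

lemma inv_R_bound:
  assumes "continuous_on {a..b} f" "\<And>y. y \<in> {a..b} \<Longrightarrow> \<bar>f y\<bar> \<le> M" "x \<in> {a..b}"
  shows "\<bar>inv_R a b \<alpha> f x\<bar> \<le> M"
  unfolding inv_R_reflect[OF assms(1,3)] using assms
  by (intro inv_L_bound continuous_reflect) auto

text \<open>Reflection reverses the sign of the derivative, which accounts for the minus sign
  compared with \<open>inv_L_deriv\<close>.\<close>

lemma inv_R_deriv:
  assumes deriv: "\<And>x. x \<in> {a..b} \<Longrightarrow> (f has_real_derivative f' x) (at x within {a..b})"
    and cont: "continuous_on {a..b} f'" and per: "f a = f b" and x: "x \<in> {a..b}"
  shows "inv_R a b \<alpha> f' x = - (\<alpha> * (f x - inv_R a b \<alpha> f x))"
proof -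
  have contf: "continuous_on {a..b} f"
    using deriv by (meson DERIV_continuous_on)
  note refl = continuous_reflect[OF cont]
  have x': "a + b - x \<in> {a..b}" using x by auto
  \<comment> \<open>The zero summand casts the negated derivative as a linear combination, so that
    \<open>inv_L_linear\<close> extracts the sign.\<close>
  have "inv_L a b \<alpha> (\<lambda>y. - 1 * f' (a + b - y) + 0 * f' (a + b - y)) (a + b - x) =
      \<alpha> * (f (a + b - (a + b - x)) - inv_L a b \<alpha> (\<lambda>y. f (a + b - y)) (a + b - x))"
  proof (rule inv_L_deriv[where f = "\<lambda>y. f (a + b - y)"])
    fix y assume y: "y \<in> {a..b}"
    have "((\<lambda>y. a + b - y) has_real_derivative - 1) (at y within {a..b})"
      by (auto intro!: derivative_eq_intros)
    moreover have "(\<lambda>y. a + b - y) ` {a..b} = {a..b}"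
      by (auto simp: image_iff intro: bexI[where x = "a + b - _"])
    moreover have "(f has_real_derivative f' (a + b - y)) (at (a + b - y) within {a..b})"
      using y by (intro deriv) auto
    ultimately show "((\<lambda>y. f (a + b - y)) has_real_derivative
        - 1 * f' (a + b - y) + 0 * f' (a + b - y)) (at y within {a..b})"
      using DERIV_image_chain[of f "f' (a + b - y)" "\<lambda>y. a + b - y" y "{a..b}" "- 1"]
      by (simp add: o_def)
  qed (use per x' refl in \<open>auto intro!: continuous_intros\<close>)
  then show ?thesis
    unfolding inv_L_linear[OF refl refl x'] inv_R_reflect[OF contf x] inv_R_reflect[OF cont x]
    by simp
qed

section \<open>The operator \<open>D_0\<close> and its powers\<close>

lemma D_0_eq: "D_0 a b \<alpha> f x = f x - (inv_L a b \<alpha> f x + inv_R a b \<alpha> f x) / 2"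
  by (simp add: D_0_def D_L_def D_R_def field_simps)

text \<open>The difference is the average of \<open>inv_L\<close> and \<open>inv_R\<close>, each
  bounded by \<open>M\<close>; this is the contraction property of I - \<open>D_0\<close>.\<close>

lemma D_0_bound:
  assumes "continuous_on {a..b} f" "\<And>y. y \<in> {a..b} \<Longrightarrow> \<bar>f y\<bar> \<le> M" "x \<in> {a..b}"
  shows "\<bar>f x - D_0 a b \<alpha> f x\<bar> \<le> M"
  using inv_L_bound[OF assms] inv_R_bound[OF assms] by (simp add: D_0_eq)

lemma D_0_linear:
  assumes "continuous_on {a..b} f" "continuous_on {a..b} g" "x \<in> {a..b}"
  shows "D_0 a b \<alpha> (\<lambda>y. c * f y + d * g y) x = c * D_0 a b \<alpha> f x + d * D_0 a b \<alpha> g x"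
  unfolding D_0_eq inv_L_linear[OF assms] inv_R_linear[OF assms]
  by (simp add: field_simps)

lemma funpow_D_0_cong:
  assumes "\<And>y. y \<in> {a..b} \<Longrightarrow> f y = g y" "x \<in> {a..b}"
  shows "(D_0 a b \<alpha> ^^ n) f x = (D_0 a b \<alpha> ^^ n) g x"
  using assms(2)
proof (induction n arbitrary: x)
  case 0
  then show ?case using assms(1) by simp
next
  case (Suc n)
  then show ?case
    using inv_L_cong[OF Suc.prems Suc.IH] inv_R_cong[OF Suc.prems Suc.IH] by (simp add: D_0_eq)
qed

lemma continuous_funpow_D_0:
  assumes "continuous_on {a..b} f"
  shows "continuous_on {a..b} ((D_0 a b \<alpha> ^^ n) f)"
proof (induction n)
  case (Suc n)
  have "D_0 a b \<alpha> g = (\<lambda>x. g x - (inv_L a b \<alpha> g x + inv_R a b \<alpha> g x) / 2)" for g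
    by (auto simp: D_0_eq)
  then show ?case
    using Suc by (auto intro!: continuous_intros continuous_inv_L continuous_inv_R)
qed (use assms in simp)

lemma funpow_D_0_linear:
  assumes "continuous_on {a..b} f" "continuous_on {a..b} g" "x \<in> {a..b}"
  shows "(D_0 a b \<alpha> ^^ n) (\<lambda>y. c * f y + d * g y) x
    = c * (D_0 a b \<alpha> ^^ n) f x + d * (D_0 a b \<alpha> ^^ n) g x"
  using assms(3)
proof (induction n arbitrary: x)
  case (Suc n)
  \<comment> \<open>Writing the outer operator as a first power makes \<open>funpow_D_0_cong\<close>
    applicable to it.\<close>
  have "(D_0 a b \<alpha> ^^ 1) ((D_0 a b \<alpha> ^^ n) (\<lambda>y. c * f y + d * g y)) x
      = (D_0 a b \<alpha> ^^ 1) (\<lambda>y. c * (D_0 a b \<alpha> ^^ n) f y + d * (D_0 a b \<alpha> ^^ n) g y) x"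
    by (rule funpow_D_0_cong) (use Suc in auto)
  also have "\<dots> = c * D_0 a b \<alpha> ((D_0 a b \<alpha> ^^ n) f) x + d * D_0 a b \<alpha> ((D_0 a b \<alpha> ^^ n) g) x"
    using D_0_linear[OF continuous_funpow_D_0[OF assms(1)] continuous_funpow_D_0[OF assms(2)] Suc.prems]
    by simp
  finally show ?case by simp
qed simp

text \<open>Powers of \<open>D_0\<close> are linear and commute with \<open>D_0\<close>, hence with
  c (I - \<open>D_0\<close>).\<close>

lemma funpow_D_0_commute:
  assumes "continuous_on {a..b} f" "x \<in> {a..b}"
  shows "(D_0 a b \<alpha> ^^ n) (\<lambda>y. c * (f y - D_0 a b \<alpha> f y)) x
    = c * ((D_0 a b \<alpha> ^^ n) f x - D_0 a b \<alpha> ((D_0 a b \<alpha> ^^ n) f) x)"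
proof -
  have "(\<lambda>y. c * (f y - D_0 a b \<alpha> f y)) = (\<lambda>y. c * f y + (- c) * (D_0 a b \<alpha> ^^ 1) f y)"
    by (auto simp: algebra_simps)
  then show ?thesis
    using funpow_D_0_linear[where n = n and c = c and d = "- c",
        OF assms(1) continuous_funpow_D_0[OF assms(1), of 1] assms(2)]
    by (simp add: algebra_simps flip: funpow_swap1)
qed

section \<open>Trading the operators for derivatives, and telescoping\<close>

text \<open>The derivative identities turn \<alpha> \<open>D_L\<close> f and -\<alpha>
  \<open>D_R\<close> f into \<open>inv_L\<close> and \<open>inv_R\<close> of \<open>f'\<close>;
  their average is (I - \<open>D_0\<close>) \<open>f'\<close>.\<close>

lemma D_L_minus_D_R:
  assumes "\<And>x. x \<in> {a..b} \<Longrightarrow> (f has_real_derivative f' x) (at x within {a..b})"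
    and "continuous_on {a..b} f'" "f a = f b" "x \<in> {a..b}"
  shows "\<alpha> / 2 * (D_L a b \<alpha> f x - D_R a b \<alpha> f x) = f' x - D_0 a b \<alpha> f' x"
proof -
  have "inv_L a b \<alpha> f' x = \<alpha> * (f x - inv_L a b \<alpha> f x)"
    and "inv_R a b \<alpha> f' x = - (\<alpha> * (f x - inv_R a b \<alpha> f x))"
    using assms by (auto intro!: inv_L_deriv inv_R_deriv)
  then show ?thesis
    by (simp add: D_L_def D_R_def D_0_eq algebra_simps)
qed

text \<open>Each derivative identity is used twice. In the sum of the left and right versions the
  terms with \<open>f'\<close> cancel, leaving \<open>f''\<close> and \<open>D_0\<close> f.\<close>

lemma D_0_second_deriv:
  assumes f: "\<And>x. x \<in> {a..b} \<Longrightarrow> (f has_real_derivative f' x) (at x within {a..b})" "f a = f b"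
    and f': "\<And>x. x \<in> {a..b} \<Longrightarrow> (f' has_real_derivative f'' x) (at x within {a..b})" "f' a = f' b"
    and f'': "continuous_on {a..b} f''" and x: "x \<in> {a..b}"
  shows "D_0 a b \<alpha> f x = - (1 / \<alpha>)\<^sup>2 * (f'' x - D_0 a b \<alpha> f'' x)"
proof -
  have cont: "continuous_on {a..b} f'"
    using f' by (meson DERIV_continuous_on)
  have "inv_L a b \<alpha> f'' x = \<alpha> * (f' x - inv_L a b \<alpha> f' x)"
    and "inv_R a b \<alpha> f'' x = - (\<alpha> * (f' x - inv_R a b \<alpha> f' x))"
    and "inv_L a b \<alpha> f' x = \<alpha> * (f x - inv_L a b \<alpha> f x)"
    and "inv_R a b \<alpha> f' x = - (\<alpha> * (f x - inv_R a b \<alpha> f x))"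
    using assms cont by (auto intro!: inv_L_deriv inv_R_deriv)
  then show ?thesis
    using alpha by (simp add: D_0_eq power2_eq_square field_simps)
qed

text \<open>\<open>F i\<close> stands for the i-th derivative. Each \<open>D_0\<close> is exchanged
  for two derivatives, a factor \<alpha>^(-2) and one application of the contraction I -
  \<open>D_0\<close>. An abstract family lets the induction shift the index.\<close>

lemma funpow_D_0_bound:
  assumes "\<And>i x. i < 2 * n \<Longrightarrow> x \<in> {a..b} \<Longrightarrow>
      (F i has_real_derivative F (Suc i) x) (at x within {a..b})"
    and "\<And>i. i < 2 * n \<Longrightarrow> F i a = F i b"
    and "continuous_on {a..b} (F (2 * n))"
    and "\<And>x. x \<in> {a..b} \<Longrightarrow> \<bar>F (2 * n) x\<bar> \<le> M"
    and "x \<in> {a..b}"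
  shows "\<bar>(D_0 a b \<alpha> ^^ n) (F 0) x\<bar> \<le> (1 / \<alpha>) ^ (2 * n) * M"
  using assms
proof (induction n arbitrary: F x)
  case 0
  then show ?case by simp
next
  case (Suc n)
  let ?h = "(D_0 a b \<alpha> ^^ n) (F 2)"
  have cont: "continuous_on {a..b} (F i)" if "i \<le> 2 * Suc n" for i
  proof (cases "i = 2 * Suc n")
    case False
    then show ?thesis
      using Suc.prems(1)[of i] that by (intro DERIV_continuous_on[where D = "F (Suc i)"]) auto
  qed (use Suc.prems(3) in simp)
  \<comment> \<open>The induction hypothesis is applied to the family shifted by two, whose entry 2n
    is the entry 2(n + 1) of \<open>F\<close>.\<close>
  have bound: "\<bar>?h y\<bar> \<le> (1 / \<alpha>) ^ (2 * n) * M" if "y \<in> {a..b}" for y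
    using Suc.IH[of "\<lambda>i. F (Suc (Suc i))" y] Suc.prems that by (simp add: numeral_2_eq_2)
  have "D_0 a b \<alpha> (F 0) y = - (1 / \<alpha>)\<^sup>2 * (F 2 y - D_0 a b \<alpha> (F 2) y)" if "y \<in> {a..b}" for y
    using Suc.prems(1)[of 0] Suc.prems(1)[of 1] Suc.prems(2)[of 0] Suc.prems(2)[of 1]
      cont[of 2] that
    by (intro D_0_second_deriv[where f' = "F 1"]) (auto simp: numeral_2_eq_2)
  then have "(D_0 a b \<alpha> ^^ n) (D_0 a b \<alpha> (F 0)) x
      = (D_0 a b \<alpha> ^^ n) (\<lambda>y. - (1 / \<alpha>)\<^sup>2 * (F 2 y - D_0 a b \<alpha> (F 2) y)) x"
    by (rule funpow_D_0_cong) (use Suc.prems in auto)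
  also have "\<dots> = - (1 / \<alpha>)\<^sup>2 * (?h x - D_0 a b \<alpha> ?h x)"
    by (intro funpow_D_0_commute cont Suc.prems) auto
  finally have "\<bar>(D_0 a b \<alpha> ^^ Suc n) (F 0) x\<bar> = (1 / \<alpha>)\<^sup>2 * \<bar>?h x - D_0 a b \<alpha> ?h x\<bar>"
    by (simp add: funpow_swap1 abs_mult)
  also have "\<dots> \<le> (1 / \<alpha>)\<^sup>2 * ((1 / \<alpha>) ^ (2 * n) * M)"
    by (intro mult_left_mono D_0_bound continuous_funpow_D_0 cont bound Suc.prems) auto
  finally show ?case
    by (simp add: power2_eq_square algebra_simps)
qed

text \<open>Up to the factor 2/\<alpha>, the summand for p is (\<open>D_0\<close>^(p-1) -
  \<open>D_0\<close>^p) \<open>f'\<close>, so only the two extreme terms survive.\<close>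

lemma D_L_minus_D_R_telescope:
  assumes f: "\<And>x. x \<in> {a..b} \<Longrightarrow> (f has_real_derivative f' x) (at x within {a..b})" "f a = f b"
    and cont: "continuous_on {a..b} f'" and v: "\<And>x. x \<in> {a..b} \<Longrightarrow> v x = f x" and x: "x \<in> {a..b}"
  shows "\<alpha> / 2 * (\<Sum>p=1..k. (D_0 a b \<alpha> ^^ (p - 1)) (\<lambda>y. D_L a b \<alpha> v y - D_R a b \<alpha> v y) x)
    = f' x - (D_0 a b \<alpha> ^^ k) f' x"
proof -
  have D: "D_L a b \<alpha> v y - D_R a b \<alpha> v y = 2 / \<alpha> * (f' y - D_0 a b \<alpha> f' y)" if y: "y \<in> {a..b}" for y
  proof -
    have "D_L a b \<alpha> v y - D_R a b \<alpha> v y = D_L a b \<alpha> f y - D_R a b \<alpha> f y"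
      using inv_L_cong[OF y v] inv_R_cong[OF y v] by (simp add: D_L_def D_R_def)
    also have "\<dots> = 2 / \<alpha> * (\<alpha> / 2 * (D_L a b \<alpha> f y - D_R a b \<alpha> f y))"
      using alpha by simp
    also have "\<alpha> / 2 * (D_L a b \<alpha> f y - D_R a b \<alpha> f y) = f' y - D_0 a b \<alpha> f' y"
      using f cont y by (intro D_L_minus_D_R)
    finally show ?thesis .
  qed
  have summand: "(D_0 a b \<alpha> ^^ n) (\<lambda>y. D_L a b \<alpha> v y - D_R a b \<alpha> v y) x
      = 2 / \<alpha> * ((D_0 a b \<alpha> ^^ n) f' x - (D_0 a b \<alpha> ^^ Suc n) f' x)" for n
  proof -
    have "(D_0 a b \<alpha> ^^ n) (\<lambda>y. D_L a b \<alpha> v y - D_R a b \<alpha> v y) x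
        = (D_0 a b \<alpha> ^^ n) (\<lambda>y. 2 / \<alpha> * (f' y - D_0 a b \<alpha> f' y)) x"
      by (rule funpow_D_0_cong) (rule D, assumption, rule x)
    also have "\<dots> = 2 / \<alpha> * ((D_0 a b \<alpha> ^^ n) f' x - D_0 a b \<alpha> ((D_0 a b \<alpha> ^^ n) f') x)"
      by (rule funpow_D_0_commute[OF cont x])
    finally show ?thesis by simp
  qed
  show ?thesis
  proof (induction k)
    case (Suc k)
    \<comment> \<open>The new summand has index \<open>Suc k\<close> and therefore exponent
      \<open>k\<close>.\<close>
    then show ?case
      using alpha summand[of k] by (simp add: distrib_left field_simps)
  qed simp
qed

end

section \<open>Derivatives on the interval and of the periodic extension\<close>

text \<open>The two-sided derivative of an extension restricts to the interval, where a < b makes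
  the derivative unique, also at the end points.\<close>

lemma deriv_on_eq:
  assumes "a < b" "(f has_real_derivative d) (at x)" "\<And>y. y \<in> {a..b} \<Longrightarrow> g y = f y" "x \<in> {a..b}"
  shows "deriv_on a b g x = d"
proof -
  have "(g has_real_derivative d) (at x within {a..b})"
    using has_field_derivative_at_within[OF assms(2)]
    by (rule has_field_derivative_transform_within[OF _ zero_less_one assms(4)]) (simp add: assms(3))
  then show ?thesis
    unfolding deriv_on_def has_real_derivative_iff_has_vector_derivative
    using assms(1,4) by (intro vector_derivative_within_closed_interval) auto
qed

text \<open>Differentiation commutes with translation, so every derivative inherits the
  period.\<close>

lemma deriv_funpow_periodic:
  fixes w :: "real \<Rightarrow> real"
  assumes "\<And>x. w (x + T) = w x"
  shows "(deriv ^^ n) w (x + T) = (deriv ^^ n) w x"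
proof (induction n arbitrary: x)
  case (Suc n)
  then show ?case
    by (simp add: deriv_def DERIV_shift)
qed (use assms in simp)

lemma Ck_real_deriv:
  assumes "Ck_real n w" "i < n"
  shows "((deriv ^^ i) w has_real_derivative (deriv ^^ Suc i) w x) (at x)"
proof -
  have "(deriv ^^ i) w differentiable_on UNIV"
    using assms by (simp add: Ck_real_def)
  then show ?thesis
    by (auto simp: differentiable_on_def real_differentiable_def intro: DERIV_deriv_iff_real_differentiable[THEN iffD2])
qed

theorem theorem3p1:
  fixes k :: nat
  assumes "k \<ge> 1"
  shows "\<exists>C::real. \<forall>(a::real) (b::real) (\<alpha>::real) (v::real \<Rightarrow> real).
    a < b \<longrightarrow> \<alpha> > 0 \<longrightarrow> periodic_Ck_on (2 * k + 1) a b v \<longrightarrow>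
    sup_norm a b (\<lambda>x. deriv_on a b v x
        - \<alpha> / 2 * (\<Sum>p=1..k. (D_0 a b \<alpha> ^^ (p - 1)) (\<lambda>y. D_L a b \<alpha> v y - D_R a b \<alpha> v y) x))
      \<le> C * (1 / \<alpha>) ^ (2 * k) * sup_norm a b ((deriv_on a b ^^ (2 * k + 1)) v)"
proof (intro exI[of _ 1] allI impI)
  fix a b \<alpha> :: real and v :: "real \<Rightarrow> real"
  assume ab: "a < b" and alpha: "\<alpha> > 0" and "periodic_Ck_on (2 * k + 1) a b v"
  then obtain w where w: "Ck_real (2 * k + 1) w" "\<And>x. w (x + (b - a)) = w x"
    and v: "\<And>x. x \<in> {a..b} \<Longrightarrow> v x = w x"
    by (auto simp: periodic_Ck_on_def)
  define W where "W i = (deriv ^^ i) w" for i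
  have W_deriv: "(W i has_real_derivative W (Suc i) x) (at x)" if "i < 2 * k + 1" for i x
    unfolding W_def by (rule Ck_real_deriv[OF w(1) that])
  note W_deriv_within = has_field_derivative_at_within[OF W_deriv]
  \<comment> \<open>Periodicity at the single point \<open>a\<close> supplies the end point
    condition of all the derivative identities.\<close>
  have W_per: "W i a = W i b" for i
    using deriv_funpow_periodic[where w = w and T = "b - a" and x = a, OF w(2)] by (simp add: W_def)
  have W_cont: "continuous_on {a..b} (W i)" if "i \<le> 2 * k + 1" for i
  proof (cases "i = 2 * k + 1")
    case True
    have "continuous_on UNIV (W (2 * k + 1))"
      using w(1) by (simp add: Ck_real_def W_def)
    then show ?thesis
      using True continuous_on_subset by blast
  next
    case False
    then show ?thesis
      using that by (intro DERIV_continuous_on[OF W_deriv_within]) auto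
  qed
  \<comment> \<open>The induction runs over all points of the interval at once, since the next
    derivative depends on nearby values.\<close>
  have iter: "(deriv_on a b ^^ i) v x = W i x" if "i \<le> 2 * k + 1" "x \<in> {a..b}" for i x
    using that
  proof (induction i arbitrary: x)
    case 0
    then show ?case using v by (simp add: W_def)
  next
    case (Suc i)
    then show ?case
      using deriv_on_eq[OF ab W_deriv] by simp
  qed
  define M where "M = sup_norm a b ((deriv_on a b ^^ (2 * k + 1)) v)"
  have M_eq: "M = (SUP x\<in>{a..b}. \<bar>W (2 * k + 1) x\<bar>)"
    unfolding M_def sup_norm_def by (intro SUP_cong refl) (simp only: iter order.refl)
  \<comment> \<open>Compactness bounds the set, so that the real supremum \<open>M\<close> is a
    genuine upper bound.\<close>
  have "compact ((\<lambda>x. \<bar>W (2 * k + 1) x\<bar>) ` {a..b})"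
    by (intro compact_continuous_image continuous_intros W_cont) auto
  then have "bdd_above ((\<lambda>x. \<bar>W (2 * k + 1) x\<bar>) ` {a..b})"
    by (intro bounded_imp_bdd_above compact_imp_bounded)
  then have M: "\<bar>W (2 * k + 1) x\<bar> \<le> M" if "x \<in> {a..b}" for x
    unfolding M_eq using that by (intro cSUP_upper)
  have W0: "W 0 = w" by (simp add: W_def)
  show "sup_norm a b (\<lambda>x. deriv_on a b v x
        - \<alpha> / 2 * (\<Sum>p=1..k. (D_0 a b \<alpha> ^^ (p - 1)) (\<lambda>y. D_L a b \<alpha> v y - D_R a b \<alpha> v y) x))
      \<le> 1 * (1 / \<alpha>) ^ (2 * k) * sup_norm a b ((deriv_on a b ^^ (2 * k + 1)) v)"
    unfolding M_def[symmetric] unfolding sup_norm_def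
  proof (rule cSUP_least)
    fix x assume x: "x \<in> {a..b}"
    have "\<alpha> / 2 * (\<Sum>p=1..k. (D_0 a b \<alpha> ^^ (p - 1)) (\<lambda>y. D_L a b \<alpha> v y - D_R a b \<alpha> v y) x)
        = W 1 x - (D_0 a b \<alpha> ^^ k) (W 1) x"
      using W_deriv_within[of 0] W_per[of 0] v x W_cont[of 1]
      by (intro D_L_minus_D_R_telescope[OF ab alpha, where f = w]) (auto simp: W0)
    moreover have "deriv_on a b v x = W 1 x"
      using iter[of 1 x] x by simp
    \<comment> \<open>The family starts at the first derivative, so its entry 2k is the derivative
      of order 2k + 1 measured by \<open>M\<close>.\<close>
    moreover have "\<bar>(D_0 a b \<alpha> ^^ k) (W (Suc 0)) x\<bar> \<le> (1 / \<alpha>) ^ (2 * k) * M"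
      using W_deriv_within W_per W_cont M x
      by (intro funpow_D_0_bound[OF ab alpha, where F = "\<lambda>i. W (Suc i)"]) auto
    ultimately show "\<bar>deriv_on a b v x
        - \<alpha> / 2 * (\<Sum>p=1..k. (D_0 a b \<alpha> ^^ (p - 1)) (\<lambda>y. D_L a b \<alpha> v y - D_R a b \<alpha> v y) x)\<bar>
      \<le> 1 * (1 / \<alpha>) ^ (2 * k) * M"
      by (simp only: One_nat_def mult_1 diff_diff_eq2 add_diff_cancel_left')
  qed (use ab in auto)
qed

end
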